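(* Let $\alpha\cdot\beta\neq 0$ and let $\mathcal{C}\subseteq\mathbb{Z}_2^\alpha\times R^\beta$ be a two-weight $\mathbb{Z}_2R$ linear code with $(\mathbf{1}^\alpha|\mathbf{0}^\beta)\in\mathcal{C}$ and $(\mathbf{0}^\alpha|\mathbf{u}^\beta)\in\mathcal{C}$. Then $\mathcal{C}$ is self-dual if and only if the generator matrix of $\mathcal{C}$ is permutation equivalent to $$\left(\begin{array}{cc|c}1&1&0\\0&0&u\end{array}\right)\quad\text{or}\quad\left(\begin{array}{cccc|cc}1&1&1&1&0&0\\0&1&0&1&0&u\\0&0&1&1&1&1\end{array}\right),$$ that is, if and only if, up to a permutation of the $\mathbb{Z}_2$-coordinates and a permutation of the $R$-coordinates, $\mathcal{C}$ is the code generated (as an $R$-module) by the rows of one of these two matrices.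
   Context: Let $R=\mathbb{Z}_2+u\mathbb{Z}_2=\{0,1,u,1+u\}$ with $u^2=0$, and $\eta:R\to\mathbb{Z}_2$, $\eta(r+uq)=r$. The set $\mathbb{Z}_2^\alpha\times R^\beta$ is an $R$-module under $d(a_1,\dots,a_\alpha\mid b_1,\dots,b_\beta)=(\eta(d)a_1,\dots,\eta(d)a_\alpha\mid db_1,\dots,db_\beta)$. A $\mathbb{Z}_2R$ linear code is an $R$-submodule $\mathcal{C}$ of $\mathbb{Z}_2^\alpha\times R^\beta$. The inner product is $\langle(\mathbf v|\mathbf w),(\mathbf x|\mathbf y)\rangle=u\sum_{i=1}^\alpha v_ix_i+\sum_{j=1}^\beta w_jy_j\in R$; $\mathcal{C}^\perp$ is the set of vectors orthogonal to all of $\mathcal{C}$; $\mathcal{C}$ is self-dual if $\mathcal{C}=\mathcal{C}^\perp$. The Lee weight on $R$ is $wt_L(0)=0$, $wt_L(1)=wt_L(1+u)=1$, $wt_L(u)=2$, extended additively to $R^\beta$, and $wt_L(\mathbf v|\mathbf w)=wt_H(\mathbf v)+wt_L(\mathbf w)$, where $wt_H$ is the Hamming weight. A code is two-weight if its nonzero codewords take exactly two distinct Lee weights. $\mathbf{a}^r$ denotes the $r$-tuple $(a,a,\dots,a)$. *)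

theory Defs
  imports "HOL-Analysis.Analysis" "HOL-Library.Z2"
begin

section \<open>The ring $R = Z_2 + u Z_2$ with $u^2 = 0$\<close>

text \<open>
  The pair \<open>Z2u r q\<close> stands for \<open>r + u q\<close>; the selector \<open>eta\<close> is the reduction map
  \<open>r + u q \<mapsto> r\<close>.
\<close>

datatype z2u = Z2u (eta: bit) (upart: bit)

lemma z2u_eq_iff: "x = y \<longleftrightarrow> eta x = eta y \<and> upart x = upart y"
  by (cases x; cases y) simp

instantiation z2u :: comm_ring_1
begin

definition zero_z2u :: z2u where "0 = Z2u 0 0"
definition one_z2u :: z2u where "1 = Z2u 1 0"
definition plus_z2u :: "z2u \<Rightarrow> z2u \<Rightarrow> z2u"
  where "x + y = Z2u (eta x + eta y) (upart x + upart y)"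
definition minus_z2u :: "z2u \<Rightarrow> z2u \<Rightarrow> z2u"
  where "x - y = Z2u (eta x - eta y) (upart x - upart y)"
definition uminus_z2u :: "z2u \<Rightarrow> z2u"
  where "- x = Z2u (- eta x) (- upart x)"
definition times_z2u :: "z2u \<Rightarrow> z2u \<Rightarrow> z2u"
  where "x * y = Z2u (eta x * eta y) (eta x * upart y + upart x * eta y)"

lemmas z2u_defs = zero_z2u_def one_z2u_def plus_z2u_def minus_z2u_def uminus_z2u_def times_z2u_def

instance
proof
  fix a b c :: z2u
  show "a * b * c = a * (b * c)"
    unfolding z2u_defs z2u.sel z2u.inject by (intro conjI) algebra+
  show "a * b = b * a"
    unfolding z2u_defs z2u.sel z2u.inject by (intro conjI) algebra+
  show "1 * a = a"
    unfolding z2u_eq_iff z2u_defs z2u.sel by simp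
  show "a + b + c = a + (b + c)"
    unfolding z2u_defs z2u.sel z2u.inject by (intro conjI) algebra+
  show "a + b = b + a"
    unfolding z2u_defs z2u.sel z2u.inject by (intro conjI) algebra+
  show "0 + a = a"
    unfolding z2u_eq_iff z2u_defs z2u.sel by simp
  show "- a + a = 0"
    unfolding z2u_defs z2u.sel z2u.inject by (intro conjI) algebra+
  show "a - b = a + - b"
    unfolding z2u_defs z2u.sel z2u.inject by (intro conjI) algebra+
  show "(a + b) * c = a * c + b * c"
    unfolding z2u_defs z2u.sel z2u.inject by (intro conjI) algebra+
  show "(0::z2u) \<noteq> 1"
    unfolding z2u_defs by simp
qed

end

lemma eta_add: "eta (x + y) = eta x + eta y"
  and eta_mult: "eta (x * y) = eta x * eta y"
  and eta_one: "eta 1 = 1"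
  by (simp_all add: plus_z2u_def times_z2u_def one_z2u_def)

lemma z2u_cases: "x = Z2u 0 0 \<or> x = Z2u 1 0 \<or> x = Z2u 0 1 \<or> x = Z2u 1 1"
  by (cases x; cases "eta x"; cases "upart x") simp_all

lemma z2u_UNIV: "(UNIV :: z2u set) = {Z2u 0 0, Z2u 1 0, Z2u 0 1, Z2u 1 1}"
  using z2u_cases by blast

instance z2u :: finite
  by standard (unfold z2u_UNIV, intro finite.intros)

definition u_elt :: z2u where "u_elt = Z2u 0 1"

definition z2u_of_bit :: "bit \<Rightarrow> z2u" where "z2u_of_bit b = Z2u b 0"

section \<open>The module $Z_2^\alpha \times R^\beta$ and its codes\<close>

text \<open>
  The coordinates are indexed by finite types \<open>'a\<close> and \<open>'b\<close>, with $\alpha$ = \<open>CARD('a)\<close> and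
  $\beta$ = \<open>CARD('b)\<close>.
\<close>

type_synonym ('a, 'b) z2r = "(bit ^ 'a) \<times> (z2u ^ 'b)"

definition z2r_scale :: "z2u \<Rightarrow> ('a::finite, 'b::finite) z2r \<Rightarrow> ('a, 'b) z2r" where
  "z2r_scale d x = (eta d *s fst x, d *s snd x)"

global_interpretation z2r: module "z2r_scale :: z2u \<Rightarrow> ('a::finite, 'b::finite) z2r \<Rightarrow> ('a, 'b) z2r"
  by unfold_locales
    (simp_all only: z2r_scale_def prod_eq_iff vec_eq_iff fst_add snd_add fst_conv snd_conv
      vector_smult_component vector_add_component distrib_left distrib_right mult.assoc
      eta_add eta_mult eta_one mult_1_left simp_thms)

definition z2r_linear_code :: "('a::finite, 'b::finite) z2r set \<Rightarrow> bool" where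
  "z2r_linear_code C \<longleftrightarrow> z2r.subspace C"

definition z2r_inner :: "('a::finite, 'b::finite) z2r \<Rightarrow> ('a, 'b) z2r \<Rightarrow> z2u" where
  "z2r_inner x y =
     u_elt * (\<Sum>i\<in>UNIV. z2u_of_bit (fst x $ i * fst y $ i)) + (\<Sum>j\<in>UNIV. snd x $ j * snd y $ j)"

definition z2r_dual :: "('a::finite, 'b::finite) z2r set \<Rightarrow> ('a, 'b) z2r set" where
  "z2r_dual C = {x. \<forall>c\<in>C. z2r_inner x c = 0}"

definition self_dual :: "('a::finite, 'b::finite) z2r set \<Rightarrow> bool" where
  "self_dual C \<longleftrightarrow> C = z2r_dual C"

definition hamming_weight :: "bit ^ 'a::finite \<Rightarrow> nat" where
  "hamming_weight v = card {i. v $ i \<noteq> 0}"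

definition lee_weight_elt :: "z2u \<Rightarrow> nat" where
  "lee_weight_elt r = (if r = 0 then 0 else if r = u_elt then 2 else 1)"

definition lee_weight :: "('a::finite, 'b::finite) z2r \<Rightarrow> nat" where
  "lee_weight x = hamming_weight (fst x) + (\<Sum>j\<in>UNIV. lee_weight_elt (snd x $ j))"

definition two_weight :: "('a::finite, 'b::finite) z2r set \<Rightarrow> bool" where
  "two_weight C \<longleftrightarrow> card (lee_weight ` (C - {0})) = 2"

section \<open>Permutation equivalence and the two generator matrices\<close>

definition permute_coords ::
  "('c \<Rightarrow> 'a) \<Rightarrow> ('d \<Rightarrow> 'b) \<Rightarrow> ('a::finite, 'b::finite) z2r \<Rightarrow> ('c::finite, 'd::finite) z2r" where
  "permute_coords \<sigma> \<tau> x = (\<chi> i. fst x $ \<sigma> i, \<chi> j. snd x $ \<tau> j)"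

text \<open>
  The two codes may be indexed by different types: a pair of bijections between the index types
  is a permutation of the $Z_2$-coordinates and one of the $R$-coordinates after numbering
  the coordinates. Its existence forces the numbers of coordinates to agree.
\<close>

definition perm_equivalent ::
  "('a::finite, 'b::finite) z2r set \<Rightarrow> ('c::finite, 'd::finite) z2r set \<Rightarrow> bool" where
  "perm_equivalent C D \<longleftrightarrow>
     (\<exists>(\<sigma> :: 'c \<Rightarrow> 'a) (\<tau> :: 'd \<Rightarrow> 'b). bij \<sigma> \<and> bij \<tau> \<and> permute_coords \<sigma> \<tau> ` C = D)"

text \<open>A generator matrix is given by the set of its rows.\<close>

definition rows_2_1 :: "(2, 1) z2r set" where
  "rows_2_1 =
    {(vector [1, 1], vector [0]),
     (vector [0, 0], vector [u_elt])}"

definition rows_4_2 :: "(4, 2) z2r set" where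
  "rows_4_2 =
    {(vector [1, 1, 1, 1], vector [0, 0]),
     (vector [0, 1, 0, 1], vector [0, u_elt]),
     (vector [0, 0, 1, 1], vector [1, 1])}"

end

theory Submission
  imports Defs
begin

text \<open>
  The words $(1|0)$, $(0|u)$ and their sum have Lee weights $\alpha$, $2\beta$ and $\alpha + 2\beta$,
  so a two-weight code has $\alpha = 2\beta$, and all nonzero words other than the sum have weight
  $\alpha$, half the length $2\alpha$ of the binary Gray image. A second-moment (Plotkin type)
  estimate then gives $|C| \le 4\alpha$, whereas self-duality gives $|C| = 2^\alpha$; hence
  $\alpha \in \{2, 4\}$.

  For $\alpha = 4$, $\beta = 2$ a codeword is determined by one binary coordinate and
  three bits of its $R$-part, so $|C| = 16$ forces words $x = (v|0,u)$ and $y = (w|1,1)$ in $C$. The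
  weights make $i \mapsto (v_i, w_i)$ a bijection onto $Z_2^2$, and so a permutation turns
  $x$ and $y$ into the last two rows of the second matrix. Both codes are self-dual, so
  containment of the rows already means equality.
\<close>

text \<open>Bit arithmetic stays in ring form, so that distributivity and the rules for finite sums
  apply.\<close>

declare add_bit_eq_xor [simp del] mult_bit_eq_and [simp del]

lemma UNIV_bit_eq: "(UNIV :: bit set) = {0, 1}"
  by auto

lemma bit_add_eq_0_iff: "a + b = 0 \<longleftrightarrow> a = b" for a b :: bit
  by (cases a; cases b) simp_all

instance bit :: finite
  by standard (simp add: UNIV_bit_eq)

section \<open>Character sums\<close>

text \<open>The nontrivial additive character of Z_2, with integer values.\<close>

definition bit_sign :: "bit \<Rightarrow> int" where
  "bit_sign b = (if b = 0 then 1 else - 1)"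

lemma bit_sign_0 [simp]: "bit_sign 0 = 1"
  by (simp add: bit_sign_def)

lemma bit_sign_1 [simp]: "bit_sign 1 = - 1"
  by (simp add: bit_sign_def)

lemma bit_sign_add: "bit_sign (a + b) = bit_sign a * bit_sign b"
  by (cases a; cases b) simp_all

text \<open>Orthogonality of characters: translation by some \<open>a\<close> with
  \<open>f a = 1\<close> permutes the finite set \<open>H\<close> and flips every sign, so the sum
  equals its own negative.\<close>

lemma sum_bit_sign:
  fixes f :: "'g::cancel_semigroup_add \<Rightarrow> bit"
  assumes "finite H"
    and closed: "\<And>x y. x \<in> H \<Longrightarrow> y \<in> H \<Longrightarrow> x + y \<in> H"
    and additive: "\<And>x y. x \<in> H \<Longrightarrow> y \<in> H \<Longrightarrow> f (x + y) = f x + f y"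
  shows "(\<Sum>x\<in>H. bit_sign (f x)) = (if \<exists>x\<in>H. f x \<noteq> 0 then 0 else int (card H))"
proof (cases "\<exists>x\<in>H. f x \<noteq> 0")
  case True
  then obtain a where a: "a \<in> H" "f a = 1"
    by auto
  have "inj_on ((+) a) H"
    by (simp add: inj_on_def)
  then have "bij_betw ((+) a) H H"
    using a closed \<open>finite H\<close> by (simp add: bij_betw_def endo_inj_surj image_subset_iff)
  then have "(\<Sum>x\<in>H. bit_sign (f x)) = (\<Sum>x\<in>H. bit_sign (f (a + x)))"
    by (rule sum.reindex_bij_betw [symmetric])
  also have "\<dots> = - (\<Sum>x\<in>H. bit_sign (f x))"
    using a by (simp add: additive bit_sign_add sum_negf)
  finally show ?thesis
    using True by simp
qed simp

section \<open>The inner product and the dual code\<close>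

lemma z2u_sel_simps [simp]:
  "eta 0 = 0" "upart 0 = 0" "eta 1 = 1" "upart 1 = 0"
  "eta (x + y) = eta x + eta y" "upart (x + y) = upart x + upart y"
  "eta (x - y) = eta x - eta y" "upart (x - y) = upart x - upart y"
  "eta (x * y) = eta x * eta y" "upart (x * y) = eta x * upart y + upart x * eta y"
  "eta u_elt = 0" "upart u_elt = 1"
  "eta (z2u_of_bit b) = b" "upart (z2u_of_bit b) = 0"
  by (simp_all add: zero_z2u_def one_z2u_def plus_z2u_def minus_z2u_def times_z2u_def
      u_elt_def z2u_of_bit_def)

lemma eta_sum [simp]: "eta (sum f A) = (\<Sum>x\<in>A. eta (f x))"
  by (induction A rule: infinite_finite_induct) simp_all

lemma upart_sum [simp]: "upart (sum f A) = (\<Sum>x\<in>A. upart (f x))"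
  by (induction A rule: infinite_finite_induct) simp_all

lemma z2r_eq_iff:
  fixes x y :: "('a::finite, 'b::finite) z2r"
  shows "x = y \<longleftrightarrow> (\<forall>i. fst x $ i = fst y $ i) \<and> (\<forall>j. snd x $ j = snd y $ j)"
  by (auto simp: prod_eq_iff vec_eq_iff)

text \<open>Splits the inner product into its reduction and its u-part; the binary coordinates carry
  a factor u and enter only the latter.\<close>

lemma z2r_inner_eq_0_iff:
  "z2r_inner x y = 0 \<longleftrightarrow>
    (\<Sum>j\<in>UNIV. eta (snd x $ j) * eta (snd y $ j)) = 0 \<and>
    (\<Sum>i\<in>UNIV. fst x $ i * fst y $ i) +
      (\<Sum>j\<in>UNIV. eta (snd x $ j) * upart (snd y $ j) + upart (snd x $ j) * eta (snd y $ j)) = 0"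
  by (simp add: z2u_eq_iff z2r_inner_def)

lemma z2r_inner_commute: "z2r_inner x y = z2r_inner y x"
  by (simp add: z2r_inner_def mult.commute)

lemma z2r_inner_add_right: "z2r_inner x (y + z) = z2r_inner x y + z2r_inner x z"
  by (simp add: z2u_eq_iff z2r_inner_def distrib_left sum.distrib)

lemma z2r_inner_add_left: "z2r_inner (x + y) z = z2r_inner x z + z2r_inner y z"
  by (metis z2r_inner_add_right z2r_inner_commute)

lemma z2r_inner_scale_right: "z2r_inner x (z2r_scale d y) = d * z2r_inner x y"
  by (simp add: z2u_eq_iff z2r_inner_def z2r_scale_def algebra_simps sum_distrib_left sum.distrib)

lemma z2r_inner_zero_right [simp]: "z2r_inner x 0 = 0"
  by (simp add: z2r_inner_def z2u_eq_iff)

lemma z2r_inner_zero_left [simp]: "z2r_inner 0 x = 0"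
  by (simp add: z2r_inner_def z2u_eq_iff)

lemma subspace_orthogonal: "z2r.subspace {y. \<forall>x\<in>S. z2r_inner x y = 0}"
  by (auto simp: z2r.subspace_def z2r_inner_add_right z2r_inner_scale_right)

text \<open>The vectors orthogonal to a fixed \<open>x\<close> form a submodule, so orthogonality
  need only be tested on generators.\<close>

lemma z2r_dual_span: "z2r_dual (z2r.span S) = z2r_dual S"
proof -
  have "z2r.span S \<subseteq> {y. z2r_inner x y = 0}" if "x \<in> z2r_dual S" for x
    using that subspace_orthogonal [of "{x}"]
    by (intro z2r.span_minimal) (auto simp: z2r_dual_def)
  then show ?thesis
    by (auto simp: z2r_dual_def intro: z2r.span_base)
qed

lemma span_subset_dual_span:
  assumes "S \<subseteq> z2r_dual S"
  shows "z2r.span S \<subseteq> z2r_dual (z2r.span S)"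
proof -
  have "z2r_dual S = {y. \<forall>x\<in>S. z2r_inner x y = 0}"
    by (auto simp: z2r_dual_def z2r_inner_commute)
  then have "z2r.subspace (z2r_dual S)"
    by (simp only: subspace_orthogonal)
  with assms show ?thesis
    unfolding z2r_dual_span by (intro z2r.span_minimal)
qed

text \<open>Duality reverses inclusions, so D, being its own dual, lies in the dual of C, which is
  C.\<close>

lemma self_dual_subset_eq:
  assumes "self_dual C" "self_dual D" "C \<subseteq> D"
  shows "C = D"
  using assms unfolding self_dual_def z2r_dual_def by blast

text \<open>Unit vectors detect a binary coordinate; on an R-coordinate, u detects the reduction and
  1 the u-part.\<close>

lemma upart_inner_nondegenerate:
  assumes "x \<noteq> 0"
  shows "\<exists>y. upart (z2r_inner x y) \<noteq> 0"
proof -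
  consider i where "fst x $ i \<noteq> 0" | j where "eta (snd x $ j) \<noteq> 0" | j where "upart (snd x $ j) \<noteq> 0"
    using assms by (auto simp: z2r_eq_iff z2u_eq_iff)
  then show ?thesis
  proof cases
    case 1
    then have "upart (z2r_inner x (axis i 1, 0)) \<noteq> 0"
      by (simp add: z2r_inner_def axis_def if_distrib cong: if_cong)
    then show ?thesis ..
  next
    case 2
    then have "upart (z2r_inner x (0, axis j u_elt)) \<noteq> 0"
      by (simp add: z2r_inner_def axis_def if_distrib sum.distrib cong: if_cong)
    then show ?thesis ..
  next
    case 3
    then have "upart (z2r_inner x (0, axis j 1)) \<noteq> 0"
      by (simp add: z2r_inner_def axis_def if_distrib sum.distrib cong: if_cong)
    then show ?thesis ..
  qed
qed

text \<open>
  Since $C$ is closed under multiplication by $u$, its dual is its orthogonal complement for the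
  nondegenerate binary form given by the $u$-part of the inner product.
\<close>

lemma in_dual_iff_upart:
  assumes "z2r.subspace C"
  shows "x \<in> z2r_dual C \<longleftrightarrow> (\<forall>c\<in>C. upart (z2r_inner x c) = 0)"
proof
  assume upart: "\<forall>c\<in>C. upart (z2r_inner x c) = 0"
  have "z2r_inner x c = 0" if "c \<in> C" for c
  proof -
    have "eta (z2r_inner x c) = upart (z2r_inner x (z2r_scale u_elt c))"
      unfolding z2r_inner_scale_right by simp
    then show ?thesis
      using that assms upart by (simp add: z2u_eq_iff z2r.subspace_scale)
  qed
  then show "x \<in> z2r_dual C"
    by (simp add: z2r_dual_def)
qed (simp add: z2r_dual_def)

text \<open>Double counting of a character sum over all \<open>x\<close> and all \<open>c\<close> in
  C: for fixed \<open>x\<close> it vanishes unless \<open>x\<close> is in the dual, for fixed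
  \<open>c\<close> it vanishes unless \<open>c = 0\<close>.\<close>

lemma card_mult_card_dual:
  fixes C :: "('a::finite, 'b::finite) z2r set"
  assumes "z2r.subspace C"
  shows "card C * card (z2r_dual C) = CARD(('a, 'b) z2r)"
proof -
  let ?s = "\<lambda>x c. bit_sign (upart (z2r_inner x c))"
  have "(\<Sum>x\<in>UNIV. \<Sum>c\<in>C. ?s x c) = (\<Sum>x\<in>UNIV. if x \<in> z2r_dual C then int (card C) else 0)"
  proof (rule sum.cong [OF refl])
    fix x :: "('a, 'b) z2r"
    have "(\<Sum>c\<in>C. ?s x c) = (if \<exists>c\<in>C. upart (z2r_inner x c) \<noteq> 0 then 0 else int (card C))"
      using assms by (intro sum_bit_sign) (auto simp: z2r_inner_add_right z2r.subspace_add)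
    moreover have "(\<exists>c\<in>C. upart (z2r_inner x c) \<noteq> 0) \<longleftrightarrow> x \<notin> z2r_dual C"
      unfolding in_dual_iff_upart [OF assms] by blast
    ultimately show "(\<Sum>c\<in>C. ?s x c) = (if x \<in> z2r_dual C then int (card C) else 0)"
      by simp
  qed
  also have "\<dots> = int (card C * card (z2r_dual C))"
    by (simp add: sum.If_cases)
  finally have 1: "(\<Sum>x\<in>UNIV. \<Sum>c\<in>C. ?s x c) = int (card C * card (z2r_dual C))" .
  have "(\<Sum>x\<in>UNIV. \<Sum>c\<in>C. ?s x c) = (\<Sum>c\<in>C. \<Sum>x\<in>UNIV. ?s x c)"
    by (rule sum.swap)
  also have "\<dots> = (\<Sum>c\<in>C. if c = 0 then int CARD(('a, 'b) z2r) else 0)"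
  proof (rule sum.cong [OF refl])
    fix c :: "('a, 'b) z2r"
    have "(\<Sum>x\<in>UNIV. ?s x c) =
        (if \<exists>x\<in>UNIV. upart (z2r_inner x c) \<noteq> 0 then 0 else int CARD(('a, 'b) z2r))"
      by (intro sum_bit_sign) (auto simp: z2r_inner_add_left)
    moreover have "(\<exists>x\<in>UNIV. upart (z2r_inner x c) \<noteq> 0) \<longleftrightarrow> c \<noteq> 0"
      using upart_inner_nondegenerate [of c] by (auto simp: z2r_inner_commute)
    ultimately show "(\<Sum>x\<in>UNIV. ?s x c) = (if c = 0 then int CARD(('a, 'b) z2r) else 0)"
      by simp
  qed
  also have "\<dots> = int CARD(('a, 'b) z2r)"
    using z2r.subspace_0 [OF assms] by simp
  finally have "(\<Sum>x\<in>UNIV. \<Sum>c\<in>C. ?s x c) = int CARD(('a, 'b) z2r)" .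
  with 1 show ?thesis
    by linarith
qed

lemma card_bit: "CARD(bit) = 2"
  by (simp add: UNIV_bit_eq)

lemma card_z2u: "CARD(z2u) = 4"
  by (simp add: z2u_UNIV)

lemma card_self_dual:
  fixes C :: "('a::finite, 'b::finite) z2r set"
  assumes "z2r.subspace C" "self_dual C"
  shows "card C ^ 2 = 2 ^ CARD('a) * 4 ^ CARD('b)"
  using card_mult_card_dual [OF assms(1)] assms(2)
  by (simp add: self_dual_def power2_eq_square card_bit card_z2u)

lemma card_self_dual_eq_power:
  fixes C :: "('a::finite, 'b::finite) z2r set"
  assumes "z2r.subspace C" "self_dual C" "CARD('a) = 2 * CARD('b)"
  shows "card C = 2 ^ CARD('a)"
proof -
  have "card C ^ 2 = (2 ^ CARD('a)) ^ 2"
    unfolding card_self_dual [OF assms(1,2)] assms(3)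
    by (simp add: power_mult power2_eq_square flip: power_mult_distrib)
  then show ?thesis
    by simp
qed

section \<open>The Gray map and the second moment of the weights\<close>

text \<open>The Gray map, sending r + uq to the pair (q, q + r); the bit \<open>b\<close> selects
  the entry of the pair.\<close>

definition gray :: "('a::finite, 'b::finite) z2r \<Rightarrow> 'a + 'b \<times> bit \<Rightarrow> bit" where
  "gray x k = (case k of Inl i \<Rightarrow> fst x $ i | Inr (j, b) \<Rightarrow> upart (snd x $ j) + b * eta (snd x $ j))"

lemma gray_add: "gray (x + y) k = gray x k + gray y k"
  by (simp add: gray_def distrib_left split: sum.split)

text \<open>The Gray map turns Lee weight into Hamming weight, and a sum of signs is the length
  minus twice the number of ones.\<close>

lemma sum_bit_sign_gray:
  fixes x :: "('a::finite, 'b::finite) z2r"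
  shows "(\<Sum>k\<in>UNIV. bit_sign (gray x k)) = int (CARD('a) + 2 * CARD('b)) - 2 * int (lee_weight x)"
proof -
  have hamming: "(\<Sum>i\<in>UNIV. bit_sign (fst x $ i)) = int CARD('a) - 2 * int (hamming_weight (fst x))"
  proof -
    have "bit_sign b = 1 - 2 * (if b \<noteq> 0 then 1 else 0)" for b
      by (simp add: bit_sign_def)
    then show ?thesis
      by (simp add: sum_subtractf hamming_weight_def sum.If_cases flip: sum_distrib_left)
  qed
  have elt: "bit_sign (upart r) + bit_sign (upart r + eta r) = 2 - 2 * int (lee_weight_elt r)" for r
    using z2u_cases [of r] by (auto simp: lee_weight_elt_def zero_z2u_def u_elt_def)
  have "(\<Sum>k\<in>UNIV. bit_sign (gray x k)) =
      (\<Sum>i\<in>UNIV. bit_sign (gray x (Inl i))) + (\<Sum>p\<in>UNIV. bit_sign (gray x (Inr p)))"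
    by (simp add: sum.Plus flip: UNIV_Plus_UNIV)
  also have "(\<Sum>p\<in>UNIV. bit_sign (gray x (Inr p))) =
      (\<Sum>j\<in>UNIV. \<Sum>b\<in>UNIV. bit_sign (gray x (Inr (j, b))))"
    by (simp add: sum.cartesian_product flip: UNIV_Times_UNIV)
  also have "\<dots> = (\<Sum>j\<in>UNIV. 2 - 2 * int (lee_weight_elt (snd x $ j)))"
    by (simp add: UNIV_bit_eq gray_def elt)
  finally show ?thesis
    by (simp add: gray_def hamming lee_weight_def sum_subtractf flip: sum_distrib_left)
qed

text \<open>The square expands over pairs of Gray coordinates; the diagonal pairs alone contribute
  the left-hand side.\<close>

lemma sum_gray_square_ge:
  fixes C :: "('a::finite, 'b::finite) z2r set"
  assumes "z2r.subspace C"
  shows "int (CARD('a) + 2 * CARD('b)) * int (card C) \<le>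
    (\<Sum>c\<in>C. (int (CARD('a) + 2 * CARD('b)) - 2 * int (lee_weight c)) ^ 2)"
proof -
  let ?S = "\<lambda>k l. \<Sum>c\<in>C. bit_sign (gray c k + gray c l)"
  have S: "?S k l = (if \<exists>c\<in>C. gray c k + gray c l \<noteq> 0 then 0 else int (card C))" for k l
    using assms by (intro sum_bit_sign) (auto simp: gray_add z2r.subspace_add)
  have "int (CARD('a) + 2 * CARD('b)) * int (card C) = (\<Sum>k::'a + 'b \<times> bit\<in>UNIV. int (card C))"
    by (simp add: card_bit card_UNIV_sum)
  also have "\<dots> = (\<Sum>k\<in>UNIV. ?S k k)"
    by simp
  \<comment> \<open>Off-diagonal terms are character sums over C, hence 0 or |C|, and may be
    added.\<close>
  also have "\<dots> \<le> (\<Sum>k\<in>UNIV. \<Sum>l\<in>UNIV. ?S k l)"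
    by (intro sum_mono member_le_sum) (simp_all add: S)
  also have "\<dots> = (\<Sum>k\<in>UNIV. \<Sum>c\<in>C. \<Sum>l\<in>UNIV. bit_sign (gray c k) * bit_sign (gray c l))"
    unfolding bit_sign_add by (intro sum.cong refl sum.swap)
  also have "\<dots> = (\<Sum>c\<in>C. \<Sum>k\<in>UNIV. \<Sum>l\<in>UNIV. bit_sign (gray c k) * bit_sign (gray c l))"
    by (rule sum.swap)
  also have "\<dots> = (\<Sum>c\<in>C. (\<Sum>k\<in>UNIV. bit_sign (gray c k)) ^ 2)"
    by (simp add: sum_product power2_eq_square)
  finally show ?thesis
    unfolding sum_bit_sign_gray .
qed

section \<open>Weights and size of a two-weight code\<close>

lemma lee_weight_0 [simp]: "lee_weight 0 = 0"
  by (simp add: lee_weight_def hamming_weight_def lee_weight_elt_def)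

lemma lee_weight_ones_zero: "lee_weight ((vec 1, vec 0) :: ('a::finite, 'b::finite) z2r) = CARD('a)"
  by (simp add: lee_weight_def hamming_weight_def lee_weight_elt_def)

lemma lee_weight_zero_us: "lee_weight ((vec 0, vec u_elt) :: ('a::finite, 'b::finite) z2r) = 2 * CARD('b)"
  by (simp add: lee_weight_def hamming_weight_def lee_weight_elt_def z2u_eq_iff)

lemma lee_weight_ones_us:
  "lee_weight ((vec 1, vec u_elt) :: ('a::finite, 'b::finite) z2r) = CARD('a) + 2 * CARD('b)"
  by (simp add: lee_weight_def hamming_weight_def lee_weight_elt_def z2u_eq_iff)

text \<open>Maximal total weight forces maximal weight in every coordinate, and u is the only
  element of R of weight 2.\<close>

lemma lee_weight_max_imp:
  fixes x :: "('a::finite, 'b::finite) z2r"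
  assumes "lee_weight x = CARD('a) + 2 * CARD('b)"
  shows "x = (vec 1, vec u_elt)"
proof -
  have h: "hamming_weight (fst x) \<le> CARD('a)"
    unfolding hamming_weight_def by (rule card_mono) auto
  have elt: "lee_weight_elt r \<le> 2" for r
    by (simp add: lee_weight_elt_def)
  then have l: "(\<Sum>j\<in>UNIV. lee_weight_elt (snd x $ j)) \<le> (\<Sum>j::'b\<in>UNIV. 2)"
    by (intro sum_mono)
  have "hamming_weight (fst x) = CARD('a)" and
    s: "(\<Sum>j\<in>UNIV. lee_weight_elt (snd x $ j)) = (\<Sum>j::'b\<in>UNIV. 2)"
    using assms h l by (simp_all add: lee_weight_def)
  then have "{i. fst x $ i \<noteq> 0} = UNIV"
    unfolding hamming_weight_def by (intro card_subset_eq) auto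
  moreover have "lee_weight_elt (snd x $ j) = 2" for j
  proof (rule ccontr)
    assume "lee_weight_elt (snd x $ j) \<noteq> 2"
    with elt have "(\<Sum>j\<in>UNIV. lee_weight_elt (snd x $ j)) < (\<Sum>j::'b\<in>UNIV. 2)"
      by (intro sum_strict_mono_ex1) (auto simp: order.strict_iff_order)
    with s show False
      by simp
  qed
  then have "snd x $ j = u_elt" for j
    by (metis lee_weight_elt_def zero_neq_numeral numeral_eq_one_iff semiring_norm(85))
  ultimately show ?thesis
    by (auto simp: z2r_eq_iff)
qed

lemma two_weight_weights:
  fixes C :: "('a::finite, 'b::finite) z2r set"
  assumes "z2r.subspace C" "two_weight C" and ones: "(vec 1, vec 0) \<in> C" and us: "(vec 0, vec u_elt) \<in> C"
  shows "CARD('a) = 2 * CARD('b)"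
    and "c \<in> C \<Longrightarrow> c \<noteq> 0 \<Longrightarrow> c \<noteq> (vec 1, vec u_elt) \<Longrightarrow> lee_weight c = CARD('a)"
proof -
  let ?W = "lee_weight ` (C - {0})"
  have W: "card ?W = 2"
    using assms by (simp add: two_weight_def)
  have "(vec 1, vec u_elt) = (vec 1, vec 0) + ((vec 0, vec u_elt) :: ('a, 'b) z2r)"
    by (simp add: z2r_eq_iff)
  with assms have all: "(vec 1, vec u_elt) \<in> C"
    using z2r.subspace_add by metis
  have nz: "(vec 1, vec 0) \<noteq> (0 :: ('a, 'b) z2r)" "(vec 0, vec u_elt) \<noteq> (0 :: ('a, 'b) z2r)"
    "(vec 1, vec u_elt) \<noteq> (0 :: ('a, 'b) z2r)"
    by (simp_all add: z2r_eq_iff z2u_eq_iff)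
  have sub: "{CARD('a), 2 * CARD('b), CARD('a) + 2 * CARD('b)} \<subseteq> ?W"
    using nz all ones us lee_weight_ones_zero lee_weight_zero_us lee_weight_ones_us
    by (metis (no_types, lifting) Diff_iff image_eqI insert_subset empty_subsetI singletonD)
  then have "card {CARD('a), 2 * CARD('b), CARD('a) + 2 * CARD('b)} \<le> 2"
    using W by (metis card_mono finite_imageI finite)
  then show eq: "CARD('a) = 2 * CARD('b)"
    \<comment> \<open>Index types are nonempty, so the third weight exceeds the other two, which
      must therefore coincide.\<close>
    by (auto simp: card_insert_if split: if_splits)
  have "{CARD('a), CARD('a) + 2 * CARD('b)} = ?W"
    using sub W eq by (intro card_subset_eq) auto
  then show "lee_weight c = CARD('a)" if "c \<in> C" "c \<noteq> 0" "c \<noteq> (vec 1, vec u_elt)"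
    using that lee_weight_max_imp by blast
qed

lemma two_weight_card_le:
  fixes C :: "('a::finite, 'b::finite) z2r set"
  assumes "z2r.subspace C" "two_weight C" "(vec 1, vec 0) \<in> C" "(vec 0, vec u_elt) \<in> C"
  shows "card C \<le> 4 * CARD('a)"
proof -
  let ?n = "int (2 * CARD('a))" and ?all = "(vec 1, vec u_elt) :: ('a, 'b) z2r"
  note weights = two_weight_weights [OF assms]
  have n: "CARD('a) + 2 * CARD('b) = 2 * CARD('a)"
    using weights(1) by simp
  have "?n * int (card C) \<le> (\<Sum>c\<in>C. (?n - 2 * int (lee_weight c)) ^ 2)"
    using sum_gray_square_ge [OF assms(1)] unfolding n .
  \<comment> \<open>Words of weight \<open>?n\<close> / 2 contribute nothing; only 0 and the word of
    full weight remain.\<close>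
  also have "\<dots> \<le> (\<Sum>c\<in>C. if c \<in> {0, ?all} then ?n ^ 2 else 0)"
  proof (intro sum_mono)
    fix c assume "c \<in> C"
    then show "(?n - 2 * int (lee_weight c)) ^ 2 \<le> (if c \<in> {0, ?all} then ?n ^ 2 else 0)"
      using weights(2) [of c] lee_weight_ones_us [where 'a = 'a and 'b = 'b] n
      by (cases "c = ?all"; cases "c = 0") (simp_all del: vec_1)
  qed
  also have "\<dots> = int (card (C \<inter> {0, ?all})) * ?n ^ 2"
    by (simp add: sum.If_cases Int_def)
  also have "\<dots> \<le> 2 * ?n ^ 2"
  proof (rule mult_right_mono)
    have "card (C \<inter> {0, ?all}) \<le> card {0, ?all}"
      by (intro card_mono) auto
    also have "\<dots> \<le> 2"
      by (simp add: card_insert_if)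
    finally show "int (card (C \<inter> {0, ?all})) \<le> 2"
      by simp
  qed simp
  finally have "?n * int (card C) \<le> ?n * (2 * ?n)"
    by (simp add: power2_eq_square)
  then have "int (card C) \<le> 2 * ?n"
    by (subst (asm) mult_le_cancel_left_pos) simp_all
  then show ?thesis
    by simp
qed

lemma power2_le_4_mult:
  fixes n :: nat
  assumes "2 ^ n \<le> 4 * n"
  shows "n \<le> 4"
proof (rule ccontr)
  have "4 * m < 2 ^ m" if "5 \<le> m" for m :: nat
    using that by (induction m rule: dec_induct) auto
  moreover assume "\<not> n \<le> 4"
  ultimately show False
    using assms by (metis not_less_eq_eq eval_nat_numeral(3) leD semiring_norm(27,28) numeral_eq_Suc)
qed

lemma self_dual_two_weight_length:
  fixes C :: "('a::finite, 'b::finite) z2r set"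
  assumes "z2r.subspace C" "two_weight C" "(vec 1, vec 0) \<in> C" "(vec 0, vec u_elt) \<in> C" "self_dual C"
  shows "CARD('a) = 2 \<and> CARD('b) = 1 \<or> CARD('a) = 4 \<and> CARD('b) = 2"
proof -
  have eq: "CARD('a) = 2 * CARD('b)"
    using assms by (intro two_weight_weights)
  then have "CARD('a) \<le> 4"
    using two_weight_card_le [OF assms(1-4)] card_self_dual_eq_power [OF assms(1,5)]
    by (intro power2_le_4_mult) simp
  with eq have "CARD('b) \<le> 2"
    by simp
  then have "CARD('b) \<in> {1, 2}"
    by (cases "CARD('b)") auto
  with eq show ?thesis
    by auto
qed

section \<open>Permutation equivalence\<close>

lemma z2r_inner_permute_coords:
  assumes "bij \<sigma>" "bij \<tau>"
  shows "z2r_inner (permute_coords \<sigma> \<tau> x) (permute_coords \<sigma> \<tau> y) = z2r_inner x y"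
  using sum.reindex_bij_betw [OF assms(1), of "\<lambda>i. z2u_of_bit (fst x $ i * fst y $ i)"]
    sum.reindex_bij_betw [OF assms(2), of "\<lambda>j. snd x $ j * snd y $ j"]
  by (simp add: z2r_inner_def permute_coords_def)

lemma bij_permute_coords:
  assumes "bij \<sigma>" "bij \<tau>"
  shows "bij (permute_coords \<sigma> \<tau>)"
proof (rule o_bij)
  show "permute_coords (inv \<sigma>) (inv \<tau>) \<circ> permute_coords \<sigma> \<tau> = id"
    using assms by (auto simp: fun_eq_iff permute_coords_def vec_eq_iff bij_inv_eq_iff surj_f_inv_f bij_is_surj)
  show "permute_coords \<sigma> \<tau> \<circ> permute_coords (inv \<sigma>) (inv \<tau>) = id"
    using assms by (auto simp: fun_eq_iff permute_coords_def vec_eq_iff inv_f_f bij_is_inj)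
qed

text \<open>A coordinate permutation is a bijection preserving the inner product, so it commutes
  with taking duals.\<close>

lemma z2r_dual_permute_coords:
  assumes "bij \<sigma>" "bij \<tau>"
  shows "z2r_dual (permute_coords \<sigma> \<tau> ` C) = permute_coords \<sigma> \<tau> ` z2r_dual C"
proof
  show "z2r_dual (permute_coords \<sigma> \<tau> ` C) \<subseteq> permute_coords \<sigma> \<tau> ` z2r_dual C"
  proof
    fix y assume y: "y \<in> z2r_dual (permute_coords \<sigma> \<tau> ` C)"
    obtain x where "y = permute_coords \<sigma> \<tau> x"
      using bij_permute_coords [OF assms] by (metis bij_pointE)
    with y show "y \<in> permute_coords \<sigma> \<tau> ` z2r_dual C"
      by (simp add: z2r_dual_def z2r_inner_permute_coords [OF assms])
  qed
qed (auto simp: z2r_dual_def z2r_inner_permute_coords [OF assms])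

lemma self_dual_permute_coords:
  assumes "bij \<sigma>" "bij \<tau>"
  shows "self_dual (permute_coords \<sigma> \<tau> ` C) \<longleftrightarrow> self_dual C"
  using bij_is_inj [OF bij_permute_coords [OF assms]]
  by (simp add: self_dual_def z2r_dual_permute_coords [OF assms] inj_image_eq_iff)

lemma subspace_permute_coords:
  assumes "z2r.subspace C"
  shows "z2r.subspace (permute_coords \<sigma> \<tau> ` C)"
proof -
  have "permute_coords \<sigma> \<tau> 0 = 0"
    by (simp add: permute_coords_def z2r_eq_iff)
  moreover have "permute_coords \<sigma> \<tau> x + permute_coords \<sigma> \<tau> y = permute_coords \<sigma> \<tau> (x + y)" for x y
    by (simp add: permute_coords_def z2r_eq_iff)
  moreover have "z2r_scale d (permute_coords \<sigma> \<tau> x) = permute_coords \<sigma> \<tau> (z2r_scale d x)" for x d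
    by (simp add: permute_coords_def z2r_scale_def z2r_eq_iff)
  ultimately show ?thesis
    using assms unfolding z2r.subspace_def by (auto intro: rev_image_eqI)
qed

lemma perm_equivalent_self_dual:
  assumes "perm_equivalent C D" "self_dual D"
  shows "self_dual C"
  using assms by (auto simp: perm_equivalent_def self_dual_permute_coords)

text \<open>Between self-dual codes inclusion is equality, so it suffices to find the generators in
  the permuted code.\<close>

lemma perm_equivalent_spanI:
  assumes "bij \<sigma>" "bij \<tau>" "z2r.subspace C" "self_dual C" "self_dual (z2r.span S)"
    and "S \<subseteq> permute_coords \<sigma> \<tau> ` C"
  shows "perm_equivalent C (z2r.span S)"
proof -
  have "z2r.span S \<subseteq> permute_coords \<sigma> \<tau> ` C"
    using assms by (intro z2r.span_minimal subspace_permute_coords)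
  then have "z2r.span S = permute_coords \<sigma> \<tau> ` C"
    using assms by (intro self_dual_subset_eq) (simp_all add: self_dual_permute_coords)
  with assms show ?thesis
    unfolding perm_equivalent_def by blast
qed

section \<open>The two generator matrices\<close>

lemma vector_4 [simp]:
  "vector [a, b, c, d] $ (1::4) = a" "vector [a, b, c, d] $ (2::4) = b"
  "vector [a, b, c, d] $ (3::4) = c" "vector [a, b, c, d] $ (4::4) = d"
  unfolding vector_def by simp_all

lemma self_dual_rows_2_1: "self_dual (z2r.span rows_2_1)"
proof -
  have "rows_2_1 \<subseteq> z2r_dual rows_2_1"
    by (auto simp: rows_2_1_def z2r_dual_def z2r_inner_eq_0_iff sum_1 sum_2)
  moreover have "x \<in> z2r.span rows_2_1" if "x \<in> z2r_dual rows_2_1" for x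
  proof -
    have orth: "fst x $ 1 + fst x $ 2 = 0" "eta (snd x $ 1) = 0"
      using that by (auto simp: rows_2_1_def z2r_dual_def z2r_inner_eq_0_iff sum_1 sum_2)
    \<comment> \<open>The orthogonality relations make both binary coordinates equal and the
      R-coordinate a multiple of u.\<close>
    have "x = z2r_scale (z2u_of_bit (fst x $ 1)) (vector [1, 1], vector [0]) +
        z2r_scale (z2u_of_bit (upart (snd x $ 1))) (vector [0, 0], vector [u_elt])"
      using orth unfolding z2r_eq_iff z2u_eq_iff
      by (auto simp: z2r_scale_def forall_1 forall_2 bit_add_eq_0_iff)
    moreover have "\<dots> \<in> z2r.span rows_2_1"
      by (intro z2r.span_add z2r.span_scale z2r.span_base) (simp_all add: rows_2_1_def)
    ultimately show ?thesis
      by simp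
  qed
  ultimately show ?thesis
    using span_subset_dual_span [of rows_2_1] unfolding self_dual_def z2r_dual_span by blast
qed

lemma self_dual_rows_4_2: "self_dual (z2r.span rows_4_2)"
proof -
  have "rows_4_2 \<subseteq> z2r_dual rows_4_2"
    by (auto simp: rows_4_2_def z2r_dual_def z2r_inner_eq_0_iff sum_2 sum_4)
  moreover have "x \<in> z2r.span rows_4_2" if "x \<in> z2r_dual rows_4_2" for x
  proof -
    let ?v = "\<lambda>i. fst x $ i" and ?r = "\<lambda>j. eta (snd x $ j)" and ?q = "\<lambda>j. upart (snd x $ j)"
    \<comment> \<open>The first two equations are the u-parts for the first two rows; the last two
      are the reduction and the u-part for the third.\<close>
    have orth: "?v 1 + ?v 2 + ?v 3 + ?v 4 = 0" "?v 2 + ?v 4 + ?r 2 = 0"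
      "?r 1 + ?r 2 = 0" "?v 3 + ?v 4 + (?q 1 + ?q 2) = 0"
      using that by (auto simp: rows_4_2_def z2r_dual_def z2r_inner_eq_0_iff sum_2 sum_4)
    have "a + (c + d) = b" if "a + b + c + d = 0" for a b c d :: bit
      using that by (cases a; cases b; cases c; cases d; simp)
    note v2 = this [OF orth(1)]
    have "b + r = d" if "b + d + r = 0" for b d r :: bit
      using that by (cases b; cases d; cases r; simp)
    note v4 = this [OF orth(2)]
    have "a + (b + d) = c" if "a + b + c + d = 0" for a b c d :: bit
      using that by (cases a; cases b; cases c; cases d; simp)
    with orth(1,2) have v3: "?v 1 + ?r 2 = ?v 3"
      by (metis bit_add_eq_0_iff)
    have "?r 1 = ?r 2" "?v 3 + ?v 4 + ?q 1 = ?q 2"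
      using orth(3,4) by (simp_all add: bit_add_eq_0_iff flip: add.assoc)
    note eqs = v2 v3 v4 this
    \<comment> \<open>Only the first row meets binary coordinate 1 and only the third meets
      R-coordinate 1, which fixes their coefficients. The middle one is the difference of the two
      u-parts, equal to \<open>?v 3 + ?v 4\<close> by orthogonality.\<close>
    have "x = z2r_scale (z2u_of_bit (?v 1)) (vector [1, 1, 1, 1], vector [0, 0]) +
        z2r_scale (z2u_of_bit (?v 3 + ?v 4)) (vector [0, 1, 0, 1], vector [0, u_elt]) +
        z2r_scale (snd x $ 1) (vector [0, 0, 1, 1], vector [1, 1])"
      unfolding z2r_eq_iff z2u_eq_iff forall_2 forall_4
      by (simp add: z2r_scale_def eqs)
    moreover have "\<dots> \<in> z2r.span rows_4_2"
      by (intro z2r.span_add z2r.span_scale z2r.span_base) (simp_all add: rows_4_2_def)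
    ultimately show ?thesis
      by simp
  qed
  ultimately show ?thesis
    using span_subset_dual_span [of rows_4_2] unfolding self_dual_def z2r_dual_span by blast
qed

section \<open>Moving the matrix rows into a self-dual code\<close>

lemma perm_equivalent_rows_2_1:
  fixes C :: "('a::finite, 'b::finite) z2r set"
  assumes "z2r.subspace C" "self_dual C" "(vec 1, vec 0) \<in> C" "(vec 0, vec u_elt) \<in> C"
    and "CARD('a) = 2" "CARD('b) = 1"
  shows "perm_equivalent C (z2r.span rows_2_1)"
proof -
  \<comment> \<open>Both rows are constant on each kind of coordinate, so any numbering
    works.\<close>
  obtain \<sigma> :: "2 \<Rightarrow> 'a" where \<sigma>: "bij \<sigma>"
    using finite_same_card_bij [of "UNIV :: 2 set" "UNIV :: 'a set"] assms by auto
  obtain \<tau> :: "1 \<Rightarrow> 'b" where \<tau>: "bij \<tau>"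
    using finite_same_card_bij [of "UNIV :: 1 set" "UNIV :: 'b set"] assms by auto
  have "permute_coords \<sigma> \<tau> (vec 1, vec 0) = (vector [1, 1], vector [0])"
    "permute_coords \<sigma> \<tau> (vec 0, vec u_elt) = (vector [0, 0], vector [u_elt])"
    by (simp_all add: permute_coords_def z2r_eq_iff forall_1 forall_2)
  then have "rows_2_1 \<subseteq> permute_coords \<sigma> \<tau> ` C"
    using assms(3,4) by (auto simp: rows_2_1_def image_iff intro: bexI sym)
  with \<sigma> \<tau> assms(1,2) show ?thesis
    by (intro perm_equivalent_spanI self_dual_rows_2_1)
qed

text \<open>Orthogonality to (0|u) says that the reductions of the R-coordinates sum to 0; there are
  only two of them.\<close>

lemma self_dual_eta_eq:
  fixes C :: "('a::finite, 'b::finite) z2r set"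
  assumes "self_dual C" "(vec 0, vec u_elt) \<in> C" "CARD('b) = 2" "c \<in> C"
  shows "eta (snd c $ j) = eta (snd c $ k)"
proof (cases "j = k")
  case False
  then have UNIV: "UNIV = {j, k}"
    using assms(3) by (intro card_subset_eq [symmetric]) auto
  have "z2r_inner c (vec 0, vec u_elt) = 0"
    using assms by (auto simp: self_dual_def z2r_dual_def)
  then show ?thesis
    using False by (simp add: z2r_inner_eq_0_iff UNIV bit_add_eq_0_iff)
qed simp

lemma perm_equivalent_rows_4_2:
  fixes C :: "('a::finite, 'b::finite) z2r set"
  assumes C: "z2r.subspace C" and "two_weight C" and "self_dual C"
    and ones: "(vec 1, vec 0) \<in> C" and us: "(vec 0, vec u_elt) \<in> C"
    and a: "CARD('a) = 4" and b: "CARD('b) = 2"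
  shows "perm_equivalent C (z2r.span rows_4_2)"
proof -
  obtain \<tau> :: "2 \<Rightarrow> 'b" where \<tau>: "bij \<tau>"
    using finite_same_card_bij [of "UNIV :: 2 set" "UNIV :: 'b set"] b by auto
  have UNIV: "UNIV = {\<tau> 1, \<tau> 2}"
    using bij_is_surj [OF \<tau>] by (simp add: UNIV_2)
  have "\<tau> 1 \<noteq> \<tau> 2"
    using bij_is_inj [OF \<tau>] by (simp add: inj_eq)
  have eta_eq: "eta (snd c $ \<tau> 2) = eta (snd c $ \<tau> 1)" if "c \<in> C" for c
    using self_dual_eta_eq [OF \<open>self_dual C\<close> us b that] .
  have lee: "lee_weight c =
      hamming_weight (fst c) + (lee_weight_elt (snd c $ \<tau> 1) + lee_weight_elt (snd c $ \<tau> 2))" for c :: "('a, 'b) z2r"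
    using \<open>\<tau> 1 \<noteq> \<tau> 2\<close> by (simp add: lee_weight_def UNIV)
  have weight: "c = 0 \<or> c = (vec 1, vec u_elt) \<or> lee_weight c = 4" if "c \<in> C" for c
    using two_weight_weights(2) [OF C \<open>two_weight C\<close> ones us that] a by auto
  \<comment> \<open>An R-part of weight 2 excludes both 0 and (1|u), so the total weight is
    4.\<close>
  have half: "hamming_weight (fst c) = 2"
    if "c \<in> C" "lee_weight_elt (snd c $ \<tau> 1) + lee_weight_elt (snd c $ \<tau> 2) = 2" for c
    using weight [OF that(1)] that(2) lee [of c] by (auto simp: lee_weight_elt_def z2u_eq_iff)

  \<comment> \<open>Four bits for a code of 16 words: injectivity makes \<open>F\<close> onto, so
    words with prescribed bits exist. \<open>undefined\<close> serves as an arbitrary fixed binary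
    coordinate.\<close>
  define F where "F c = (fst c $ undefined, eta (snd c $ \<tau> 1), upart (snd c $ \<tau> 1), upart (snd c $ \<tau> 2))"
    for c :: "('a, 'b) z2r"
  have "inj_on F C"
  proof (rule inj_onI)
    fix x y assume xy: "x \<in> C" "y \<in> C" "F x = F y"
    have d: "x - y \<in> C"
      using C xy by (simp add: z2r.subspace_diff)
    have snd: "snd (x - y) $ \<tau> 1 = 0" "snd (x - y) $ \<tau> 2 = 0" and i: "fst (x - y) $ undefined = 0"
      using xy(3) eta_eq [OF d] by (simp_all add: F_def z2u_eq_iff)
    from snd have w: "lee_weight (x - y) = hamming_weight (fst (x - y))"
      unfolding lee by (auto simp: lee_weight_elt_def)
    have "x - y \<noteq> (vec 1, vec u_elt)"
      using i by (auto simp del: fst_diff)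
    \<comment> \<open>The difference has R-part 0 and a zero binary coordinate, so its weight is
      below 4 and it must be 0.\<close>
    have "{k. fst (x - y) $ k \<noteq> 0} \<subset> UNIV"
      using i by blast
    then have "hamming_weight (fst (x - y)) < CARD('a)"
      unfolding hamming_weight_def by (rule psubset_card_mono [OF finite])
    then show "x = y"
      using weight [OF d] w a \<open>x - y \<noteq> (vec 1, vec u_elt)\<close> by auto
  qed
  then have "card (F ` C) = CARD(bit \<times> bit \<times> bit \<times> bit)"
    using card_self_dual_eq_power [OF C \<open>self_dual C\<close>] a b by (simp add: card_image card_bit)
  then have "F ` C = UNIV"
    by (intro card_subset_eq) auto
  then have "(0, 0, 0, 1) \<in> F ` C" "(0, 1, 0, 0) \<in> F ` C"
    by simp_all
  then obtain x y where x: "x \<in> C" "(0, 0, 0, 1) = F x" and y: "y \<in> C" "(0, 1, 0, 0) = F y"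
    by (elim imageE)
  have x_snd: "snd x $ \<tau> 1 = 0" "snd x $ \<tau> 2 = u_elt"
    and y_snd: "snd y $ \<tau> 1 = 1" "snd y $ \<tau> 2 = 1"
    using x y eta_eq [of x] eta_eq [of y] by (auto simp: F_def z2u_eq_iff)

  define g where "g i = (fst x $ i, fst y $ i)" for i
  have "\<exists>i. g i = (s, t)" for s t
  proof -
    \<comment> \<open>Complementing the binary part of \<open>x\<close> when \<open>s = 0\<close>,
      and that of \<open>y\<close> when \<open>t = 0\<close>, reduces the pair (s, t) to (1,
      1).\<close>
    define x' where "x' = x + z2r_scale (z2u_of_bit (s + 1)) (vec 1, vec 0)"
    define y' where "y' = y + z2r_scale (z2u_of_bit (t + 1)) (vec 1, vec 0)"
    have mem: "x' \<in> C" "y' \<in> C" "x' + y' \<in> C"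
      using C x(1) y(1) ones by (simp_all add: x'_def y'_def z2r.subspace_add z2r.subspace_scale)
    have snd': "snd x' $ j = snd x $ j" "snd y' $ j = snd y $ j" for j
      by (simp_all add: x'_def y'_def z2r_scale_def)
    \<comment> \<open>The R-parts (0, u), (1, 1) and (1, 1 + u) all have Lee weight 2.\<close>
    have "hamming_weight (fst x') = 2" "hamming_weight (fst y') = 2" "hamming_weight (fst (x' + y')) = 2"
      by (intro half mem; simp add: snd' x_snd y_snd lee_weight_elt_def z2u_eq_iff)+
    then have card: "card {i. fst x' $ i \<noteq> 0} = 2" "card {i. fst y' $ i \<noteq> 0} = 2"
        "card {i. fst (x' + y') $ i \<noteq> 0} = 2"
      by (simp_all only: hamming_weight_def)
    \<comment> \<open>Disjoint supports would give the sum binary weight 4 instead of 2.\<close>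
    have "\<exists>i. fst x' $ i = 1 \<and> fst y' $ i = 1"
    proof (rule ccontr)
      assume disjoint: "\<not> ?thesis"
      have zero: "fst x' $ i = 0 \<or> fst y' $ i = 0" for i
        using disjoint by auto
      have "fst (x' + y') $ i \<noteq> 0 \<longleftrightarrow> fst x' $ i \<noteq> 0 \<or> fst y' $ i \<noteq> 0" for i
        using zero [of i] by auto
      then have "{i. fst (x' + y') $ i \<noteq> 0} = {i. fst x' $ i \<noteq> 0} \<union> {i. fst y' $ i \<noteq> 0}"
        by blast
      moreover have "{i. fst x' $ i \<noteq> 0} \<inter> {i. fst y' $ i \<noteq> 0} = {}"
        using zero by blast
      then have "card ({i. fst x' $ i \<noteq> 0} \<union> {i. fst y' $ i \<noteq> 0}) = 2 + 2"
        using card by (simp only: card_Un_disjoint finite)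
      ultimately show False
        using card by simp
    qed
    then obtain i where "fst x' $ i = 1" "fst y' $ i = 1"
      by blast
    then have "g i = (s, t)"
      by (cases s; cases t) (simp_all add: x'_def y'_def z2r_scale_def g_def)
    then show ?thesis ..
  qed
  then have "surj g"
    unfolding surj_def by (metis surj_pair)
  moreover have "inj g"
    using \<open>surj g\<close> a by (intro eq_card_imp_inj_on) (simp_all add: card_bit)
  ultimately have g: "bij g"
    by (simp add: bij_def)

  \<comment> \<open>The columns of the last two matrix rows run through Z_2^2; \<open>inv g\<close>
    then finds the coordinate of C showing the same pair.\<close>
  define h :: "4 \<Rightarrow> bit \<times> bit" where "h k = (vector [0, 1, 0, 1] $ k, vector [0, 0, 1, 1] $ k)" for k
  have "inj h"
    unfolding inj_def h_def by (simp add: forall_4)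
  then have "bij h"
    by (intro bij_betw_imageI card_subset_eq) (simp_all add: card_image card_bit)
  define \<sigma> where "\<sigma> = inv g \<circ> h"
  have \<sigma>: "bij \<sigma>"
    unfolding \<sigma>_def using g \<open>bij h\<close> by (simp add: bij_comp bij_imp_bij_inv)
  have "g (\<sigma> k) = h k" for k
    using g by (simp add: \<sigma>_def surj_f_inv_f bij_is_surj)
  then have fst_\<sigma>: "fst x $ \<sigma> k = vector [0, 1, 0, 1] $ k" "fst y $ \<sigma> k = vector [0, 0, 1, 1] $ k" for k
    by (simp_all add: g_def h_def)

  have "permute_coords \<sigma> \<tau> (vec 1, vec 0) = (vector [1, 1, 1, 1], vector [0, 0])"
    "permute_coords \<sigma> \<tau> x = (vector [0, 1, 0, 1], vector [0, u_elt])"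
    "permute_coords \<sigma> \<tau> y = (vector [0, 0, 1, 1], vector [1, 1])"
    by (simp_all add: permute_coords_def z2r_eq_iff forall_2 forall_4 fst_\<sigma> x_snd y_snd)
  then have "rows_4_2 \<subseteq> permute_coords \<sigma> \<tau> ` C"
    using ones x(1) y(1) unfolding rows_4_2_def by (metis empty_subsetI imageI insert_subset)
  with \<sigma> \<tau> C \<open>self_dual C\<close> show ?thesis
    by (intro perm_equivalent_spanI self_dual_rows_4_2)
qed

theorem theorem4p5:
  fixes C :: "('a::finite, 'b::finite) z2r set"
  assumes "CARD('a) * CARD('b) \<noteq> 0"
    and "z2r_linear_code C"
    and "two_weight C"
    and "(vec 1, vec 0) \<in> C"
    and "(vec 0, vec u_elt) \<in> C"
  shows "self_dual C \<longleftrightarrow>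
    perm_equivalent C (z2r.span rows_2_1) \<or> perm_equivalent C (z2r.span rows_4_2)"
proof
  have C: "z2r.subspace C"
    using assms(2) by (simp add: z2r_linear_code_def)
  assume "self_dual C"
  with self_dual_two_weight_length [OF C assms(3-5)] C assms(3-5)
  show "perm_equivalent C (z2r.span rows_2_1) \<or> perm_equivalent C (z2r.span rows_4_2)"
    using perm_equivalent_rows_2_1 perm_equivalent_rows_4_2 by blast
\<comment> \<open>Conversely, both matrices generate self-dual codes, and permutation equivalence
  carries self-duality back to C.\<close>
qed (auto intro: perm_equivalent_self_dual [OF _ self_dual_rows_2_1]
    perm_equivalent_self_dual [OF _ self_dual_rows_4_2])

end
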